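(* Let $H_1,H_2$ be commutative rings with identity, $f:H_1\to H_2$ a ring homomorphism, $J$ an ideal of $H_2$, $A$ an ideal of $H_1$, and $S$ a multiplicatively closed subset of $H_1$. (1) Suppose that $f$ is an isomorphism. If $A\bowtie^f J$ is an $(S\bowtie^f J)$-$r$-ideal of $H_1\bowtie^f J$, then $A$ is an $S$-$r$-ideal of $H_1$. (2) Suppose that $f$ is an epimorphism (i.e. surjective), $H_1$ is an integral domain and $J\subseteq \mathrm{zd}(H_2)$. If $A$ is an $S$-$r$-ideal of $H_1$, then $A\bowtie^f J$ is an $(S\bowtie^f J)$-$r$-ideal of $H_1\bowtie^f J$.
   Context: The amalgamation is the subring $H_1\bowtie^f J=\{(w,f(w)+j): w\in H_1, j\in J\}$ of $H_1\times H_2$. For a subset $T\subseteq H_1$, $T\bowtie^f J=\{(t,f(t)+j): t\in T, j\in J\}$. For an element $w$ of a ring $H$, $\mathrm{Ann}(w)=\{y\in H: yw=0\}$, and $\mathrm{zd}(H)=\{w\in H:\mathrm{Ann}(w)\neq 0\}$. A multiplicatively closed subset $S$ of a ring $H$ is a subset containing $1$ and closed under products. An ideal $A$ of $H$ is an $S$-$r$-ideal if $A\cap S=\varnothing$ and there exists $s\in S$ such that for all $w,z\in H$, if $wz\in A$ and $\mathrm{Ann}(w)=0$, then $sz\in A$. *)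

theory Defs
  imports "HOL-Algebra.Algebra"
begin

definition annihilator :: "('a, 'm) ring_scheme \<Rightarrow> 'a \<Rightarrow> 'a set"
  where "annihilator H w = {y \<in> carrier H. y \<otimes>\<^bsub>H\<^esub> w = \<zero>\<^bsub>H\<^esub>}"

definition zero_divisors :: "('a, 'm) ring_scheme \<Rightarrow> 'a set"
  where "zero_divisors H = {w \<in> carrier H. annihilator H w \<noteq> {\<zero>\<^bsub>H\<^esub>}}"

text \<open>A multiplicatively closed subset of \<open>H\<close> is a submonoid of the multiplicative
  monoid of \<open>H\<close>; \<open>\<zero>\<close> may belong to it.\<close>

definition S_r_ideal :: "'a set \<Rightarrow> 'a set \<Rightarrow> ('a, 'm) ring_scheme \<Rightarrow> bool"
  where "S_r_ideal S A H \<longleftrightarrow>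
    submonoid S H \<and> ideal A H \<and> A \<inter> S = {} \<and>
    (\<exists>s\<in>S. \<forall>w\<in>carrier H. \<forall>z\<in>carrier H.
       w \<otimes>\<^bsub>H\<^esub> z \<in> A \<and> annihilator H w = {\<zero>\<^bsub>H\<^esub>} \<longrightarrow> s \<otimes>\<^bsub>H\<^esub> z \<in> A)"

text \<open>\<open>amalg_set H2 f T J\<close> is \<open>T \<bowtie>\<^sup>f J\<close>; the argument \<open>H2\<close> only supplies the addition.\<close>

definition amalg_set :: "('b, 'n) ring_scheme \<Rightarrow> ('a \<Rightarrow> 'b) \<Rightarrow> 'a set \<Rightarrow> 'b set \<Rightarrow> ('a \<times> 'b) set"
  where "amalg_set H2 f T J = {(t, f t \<oplus>\<^bsub>H2\<^esub> j) | t j. t \<in> T \<and> j \<in> J}"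

definition amalgamation ::
  "('a, 'm) ring_scheme \<Rightarrow> ('b, 'n) ring_scheme \<Rightarrow> ('a \<Rightarrow> 'b) \<Rightarrow> 'b set \<Rightarrow> ('a \<times> 'b) ring"
  where "amalgamation H1 H2 f J =
    (RDirProd H1 H2)\<lparr>carrier := amalg_set H2 f (carrier H1) J\<rparr>"

lemma RDirProd_simps:
  "(a, b) \<otimes>\<^bsub>RDirProd R S\<^esub> (c, d) = (a \<otimes>\<^bsub>R\<^esub> c, b \<otimes>\<^bsub>S\<^esub> d)"
  "(a, b) \<oplus>\<^bsub>RDirProd R S\<^esub> (c, d) = (a \<oplus>\<^bsub>R\<^esub> c, b \<oplus>\<^bsub>S\<^esub> d)"
  "\<one>\<^bsub>RDirProd R S\<^esub> = (\<one>\<^bsub>R\<^esub>, \<one>\<^bsub>S\<^esub>)"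
  "\<zero>\<^bsub>RDirProd R S\<^esub> = (\<zero>\<^bsub>R\<^esub>, \<zero>\<^bsub>S\<^esub>)"
  by (simp_all add: RDirProd_def DirProd_def monoid.defs)

lemma amalg_set_submonoid:
  assumes "cring H1" "cring H2" "f \<in> ring_hom H1 H2" "ideal J H2" "submonoid T H1"
  shows "submonoid (amalg_set H2 f T J) (RDirProd H1 H2)"
proof -
  interpret H1: cring H1 by fact
  interpret H2: cring H2 by fact
  interpret J: ideal J H2 by fact
  interpret T: submonoid T H1 by fact
  have fc: "f x \<in> carrier H2" if "x \<in> T" for x
    using ring_hom_closed[OF assms(3)] T.subset that by blast
  show ?thesis
  proof (rule submonoid.intro)
    show "amalg_set H2 f T J \<subseteq> carrier (RDirProd H1 H2)"
      using T.subset fc J.a_subset by (auto simp: amalg_set_def RDirProd_carrier)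
  next
    have "f \<one>\<^bsub>H1\<^esub> \<oplus>\<^bsub>H2\<^esub> \<zero>\<^bsub>H2\<^esub> = \<one>\<^bsub>H2\<^esub>"
      using ring_hom_one[OF assms(3)] by simp
    then show "\<one>\<^bsub>RDirProd H1 H2\<^esub> \<in> amalg_set H2 f T J"
      unfolding amalg_set_def RDirProd_simps mem_Collect_eq
      using T.one_closed J.zero_closed by metis
  next
    fix x y assume "x \<in> amalg_set H2 f T J" "y \<in> amalg_set H2 f T J"
    then obtain a i b j where x: "x = (a, f a \<oplus>\<^bsub>H2\<^esub> i)" "a \<in> T" "i \<in> J"
      and y: "y = (b, f b \<oplus>\<^bsub>H2\<^esub> j)" "b \<in> T" "j \<in> J"
      by (auto simp: amalg_set_def)
    let ?k = "f a \<otimes>\<^bsub>H2\<^esub> j \<oplus>\<^bsub>H2\<^esub> i \<otimes>\<^bsub>H2\<^esub> (f b \<oplus>\<^bsub>H2\<^esub> j)"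
    have cl: "f a \<in> carrier H2" "f b \<in> carrier H2" "i \<in> carrier H2" "j \<in> carrier H2"
      "a \<in> carrier H1" "b \<in> carrier H1"
      using x y fc J.a_subset T.subset by auto
    have k: "?k \<in> J"
      using x y cl by (intro J.a_closed J.I_l_closed J.I_r_closed) auto
    have "(f a \<oplus>\<^bsub>H2\<^esub> i) \<otimes>\<^bsub>H2\<^esub> (f b \<oplus>\<^bsub>H2\<^esub> j) = f (a \<otimes>\<^bsub>H1\<^esub> b) \<oplus>\<^bsub>H2\<^esub> ?k"
      using cl by (simp add: ring_hom_mult[OF assms(3)] H2.l_distr H2.r_distr H2.a_ac)
    then show "x \<otimes>\<^bsub>RDirProd H1 H2\<^esub> y \<in> amalg_set H2 f T J"
      unfolding amalg_set_def x(1) y(1) RDirProd_simps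
      using k T.m_closed[OF x(2) y(2)] by auto
  qed
qed

lemma amalgamation_subring:
  assumes "cring H1" "cring H2" "f \<in> ring_hom H1 H2" "ideal J H2"
  shows "subring (carrier (amalgamation H1 H2 f J)) (RDirProd H1 H2)"
proof -
  interpret H1: cring H1 by fact
  interpret H2: cring H2 by fact
  interpret f: ring_hom_ring H1 H2 f
    using assms(3) by (intro ring_hom_ringI2 H1.ring_axioms H2.ring_axioms)
  interpret J: ideal J H2 by fact
  interpret P: ring "RDirProd H1 H2"
    by (intro RDirProd_ring H1.ring_axioms H2.ring_axioms)
  let ?K = "amalg_set H2 f (carrier H1) J"
  interpret K: submonoid ?K "RDirProd H1 H2"
    by (intro amalg_set_submonoid assms) (unfold_locales, auto)
  have "subring ?K (RDirProd H1 H2)"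
  proof (rule P.subringI)
    fix x assume "x \<in> ?K"
    then obtain a i where x: "x = (a, f a \<oplus>\<^bsub>H2\<^esub> i)" "a \<in> carrier H1" "i \<in> J"
      by (auto simp: amalg_set_def)
    have i: "i \<in> carrier H2" using x J.a_subset by auto
    have "f (\<ominus>\<^bsub>H1\<^esub> a) \<oplus>\<^bsub>H2\<^esub> \<ominus>\<^bsub>H2\<^esub> i \<oplus>\<^bsub>H2\<^esub> (f a \<oplus>\<^bsub>H2\<^esub> i) = \<zero>\<^bsub>H2\<^esub>"
      using x i H2.l_neg[of "f a \<oplus>\<^bsub>H2\<^esub> i"] by (simp add: H2.minus_add)
    then have "\<ominus>\<^bsub>RDirProd H1 H2\<^esub> x = (\<ominus>\<^bsub>H1\<^esub> a, f (\<ominus>\<^bsub>H1\<^esub> a) \<oplus>\<^bsub>H2\<^esub> \<ominus>\<^bsub>H2\<^esub> i)"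
      using x i by (intro P.minus_equality)
        (auto simp only: x(1) RDirProd_simps RDirProd_carrier H1.l_neg
          intro: f.hom_closed H1.a_inv_closed H2.a_inv_closed H2.a_closed)
    then show "\<ominus>\<^bsub>RDirProd H1 H2\<^esub> x \<in> ?K"
      unfolding amalg_set_def using x J.a_inv_closed by auto
  next
    fix x y assume "x \<in> ?K" "y \<in> ?K"
    then obtain a i b j where x: "x = (a, f a \<oplus>\<^bsub>H2\<^esub> i)" "a \<in> carrier H1" "i \<in> J"
      and y: "y = (b, f b \<oplus>\<^bsub>H2\<^esub> j)" "b \<in> carrier H1" "j \<in> J"
      by (auto simp: amalg_set_def)
    have ij: "i \<in> carrier H2" "j \<in> carrier H2" using x y J.a_subset by auto
    have "(f a \<oplus>\<^bsub>H2\<^esub> i) \<oplus>\<^bsub>H2\<^esub> (f b \<oplus>\<^bsub>H2\<^esub> j) = f (a \<oplus>\<^bsub>H1\<^esub> b) \<oplus>\<^bsub>H2\<^esub> (i \<oplus>\<^bsub>H2\<^esub> j)"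
      using x y ij by (simp add: H2.a_ac)
    then show "x \<oplus>\<^bsub>RDirProd H1 H2\<^esub> y \<in> ?K"
      unfolding amalg_set_def x(1) y(1) RDirProd_simps
      using x y J.a_closed by auto
  qed (use K.subset K.one_closed K.m_closed in auto)
  then show ?thesis by (simp add: amalgamation_def)
qed

end

theory Submission
  imports Defs
begin

text \<open>
  Everything rests on the first projection \<open>H\<^sub>1 \<bowtie>\<^sup>f J \<rightarrow> H\<^sub>1\<close>: it is a ring homomorphism, and
  \<open>T \<bowtie>\<^sup>f J\<close> is the preimage of \<open>T\<close> under it. Hence \<open>A \<bowtie>\<^sup>f J\<close> is an ideal, \<open>S \<bowtie>\<^sup>f J\<close> is
  multiplicatively closed, the two are disjoint exactly when \<open>A\<close> and \<open>S\<close> are, and a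
  product lies in \<open>A \<bowtie>\<^sup>f J\<close> exactly when the product of the first components lies in \<open>A\<close>.
  Both implications therefore come down to comparing regular elements, that is, elements with
  zero annihilator, of the two rings.

  When \<open>f\<close> is an isomorphism, the section \<open>w \<mapsto> (w, f w)\<close> carries regular elements of \<open>H\<^sub>1\<close>
  to regular elements of the amalgamation (\<open>annihilator_diagonal\<close>), so the \<open>r\<close>-ideal condition
  can be pulled back along it.

  When \<open>f\<close> is onto, \<open>H\<^sub>1\<close> is a domain and \<open>J\<close> consists of zero divisors, the projection
  carries regular elements to regular ones (\<open>regular_fst\<close>), so the condition can be lifted.
  The only nonregular element of \<open>H\<^sub>1\<close> is zero, and an element \<open>(\<zero>, i)\<close> with \<open>i \<in> J\<close> is
  never regular: some \<open>y \<noteq> \<zero>\<close> kills \<open>i\<close>, and any \<open>a\<close> with \<open>f a = y\<close> gives the nonzero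
  element \<open>(a, y)\<close> killing \<open>(\<zero>, i)\<close>.
\<close>

lemma amalgamation_simps:
  "carrier (amalgamation H1 H2 f J) = amalg_set H2 f (carrier H1) J"
  "(a, b) \<otimes>\<^bsub>amalgamation H1 H2 f J\<^esub> (c, d) = (a \<otimes>\<^bsub>H1\<^esub> c, b \<otimes>\<^bsub>H2\<^esub> d)"
  "(a, b) \<oplus>\<^bsub>amalgamation H1 H2 f J\<^esub> (c, d) = (a \<oplus>\<^bsub>H1\<^esub> c, b \<oplus>\<^bsub>H2\<^esub> d)"
  "\<one>\<^bsub>amalgamation H1 H2 f J\<^esub> = (\<one>\<^bsub>H1\<^esub>, \<one>\<^bsub>H2\<^esub>)"
  "\<zero>\<^bsub>amalgamation H1 H2 f J\<^esub> = (\<zero>\<^bsub>H1\<^esub>, \<zero>\<^bsub>H2\<^esub>)"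
  using RDirProd_simps[of H1 H2] by (simp_all add: amalgamation_def)

lemma annihilator_eq_zero_iff:
  assumes "ring H" "w \<in> carrier H"
  shows "annihilator H w = {\<zero>\<^bsub>H\<^esub>} \<longleftrightarrow>
    (\<forall>y\<in>carrier H. y \<otimes>\<^bsub>H\<^esub> w = \<zero>\<^bsub>H\<^esub> \<longrightarrow> y = \<zero>\<^bsub>H\<^esub>)"
proof -
  interpret H: ring H by fact
  show ?thesis using assms(2) by (auto simp: annihilator_def)
qed

lemma mem_zero_divisorsE:
  assumes "ring H" "w \<in> zero_divisors H"
  obtains y where "y \<in> carrier H" "y \<noteq> \<zero>\<^bsub>H\<^esub>" "y \<otimes>\<^bsub>H\<^esub> w = \<zero>\<^bsub>H\<^esub>"
  using assms annihilator_eq_zero_iff[OF assms(1)] by (auto simp: zero_divisors_def)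

locale cring_amalgamation =
  H1: cring H1 + H2: cring H2 + f: ring_hom_ring H1 H2 f + J: ideal J H2
  for H1 :: "('a, 'm) ring_scheme" and H2 :: "('b, 'n) ring_scheme"
    and f :: "'a \<Rightarrow> 'b" and J :: "'b set"
begin

abbreviation amalg :: "('a \<times> 'b) ring" where "amalg \<equiv> amalgamation H1 H2 f J"

lemma hom: "f \<in> ring_hom H1 H2" by (rule f.homh)

sublocale amalg: ring amalg
proof -
  interpret P: ring "RDirProd H1 H2"
    by (rule RDirProd_ring[OF H1.ring_axioms H2.ring_axioms])
  have "ring ((RDirProd H1 H2)\<lparr>carrier := carrier amalg\<rparr>)"
    by (rule P.subring_is_ring[OF amalgamation_subring[OF H1.is_cring H2.is_cring hom J.ideal_axioms]])
  then show "ring amalg" by (simp add: amalgamation_def)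
qed

text \<open>This lets membership in \<open>T \<bowtie>\<^sup>f J\<close> be tested on first components alone: for an element
  \<open>(t, b)\<close> of the amalgamation, \<open>b\<close> differs from \<open>f t\<close> by an element of \<open>J\<close> anyway.\<close>

lemma amalg_set_eq_vimage:
  assumes "T \<subseteq> carrier H1"
  shows "amalg_set H2 f T J = {x \<in> carrier amalg. fst x \<in> T}"
  using assms by (auto simp: amalg_set_def amalgamation_simps)

lemma diagonal_in_amalg_set: "(t, f t) \<in> amalg_set H2 f T J" if "t \<in> T" "t \<in> carrier H1"
proof -
  have "(t, f t) = (t, f t \<oplus>\<^bsub>H2\<^esub> \<zero>\<^bsub>H2\<^esub>)" using that by simp
  then show ?thesis using that J.zero_closed unfolding amalg_set_def by blast
qed

lemma fst_ring_hom: "ring_hom_ring amalg H1 fst"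
proof (intro ring_hom_ringI2 ring_hom_memI amalg.ring_axioms H1.ring_axioms)
qed (auto simp: amalgamation_simps amalg_set_def)

lemma amalg_set_ideal:
  assumes "ideal A H1"
  shows "ideal (amalg_set H2 f A J) amalg"
proof -
  interpret A: ideal A H1 by fact
  show ?thesis
    unfolding amalg_set_eq_vimage[OF A.a_subset]
    by (rule ring_hom_ring.ideal_vimage[OF fst_ring_hom assms])
qed

lemma amalg_set_submonoid_amalg:
  assumes "submonoid S H1"
  shows "submonoid (amalg_set H2 f S J) amalg"
proof -
  interpret S: submonoid S H1 by fact
  interpret SJ: submonoid "amalg_set H2 f S J" "RDirProd H1 H2"
    by (rule amalg_set_submonoid[OF H1.is_cring H2.is_cring hom J.ideal_axioms assms])
  have "amalg_set H2 f S J \<subseteq> carrier amalg"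
    using amalg_set_eq_vimage[OF S.subset] by blast
  then show ?thesis
    using SJ.one_closed SJ.m_closed by unfold_locales (simp_all add: amalgamation_def)
qed

lemma amalg_set_disjoint_iff:
  assumes "A \<subseteq> carrier H1" "S \<subseteq> carrier H1"
  shows "amalg_set H2 f A J \<inter> amalg_set H2 f S J = {} \<longleftrightarrow> A \<inter> S = {}"
proof
  assume "amalg_set H2 f A J \<inter> amalg_set H2 f S J = {}"
  then show "A \<inter> S = {}" using assms diagonal_in_amalg_set by blast
qed (auto simp: amalg_set_def)

text \<open>If \<open>(y, f y + j)\<close> kills \<open>(w, f w)\<close>, then \<open>y = \<zero>\<close> because \<open>w\<close> is regular, and then
  \<open>j = \<zero>\<close> because \<open>f w\<close> is regular as well, regularity being preserved by isomorphisms.\<close>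

lemma annihilator_diagonal:
  assumes iso: "f \<in> ring_iso H1 H2" and w: "w \<in> carrier H1"
    and reg: "annihilator H1 w = {\<zero>\<^bsub>H1\<^esub>}"
  shows "annihilator amalg (w, f w) = {\<zero>\<^bsub>amalg\<^esub>}"
proof -
  have bij: "bij_betw f (carrier H1) (carrier H2)"
    using iso by (simp add: ring_iso_def)
  have regD: "y = \<zero>\<^bsub>H1\<^esub>" if "y \<in> carrier H1" "y \<otimes>\<^bsub>H1\<^esub> w = \<zero>\<^bsub>H1\<^esub>" for y
    using reg that by (auto simp: annihilator_def)
  have reg2: "b = \<zero>\<^bsub>H2\<^esub>" if b: "b \<in> carrier H2" "b \<otimes>\<^bsub>H2\<^esub> f w = \<zero>\<^bsub>H2\<^esub>" for b
  proof -
    obtain y where y: "y \<in> carrier H1" "b = f y"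
      using bij b(1) by (auto simp: bij_betw_def)
    have "f (y \<otimes>\<^bsub>H1\<^esub> w) = f \<zero>\<^bsub>H1\<^esub>" using y w b(2) by simp
    then have "y \<otimes>\<^bsub>H1\<^esub> w = \<zero>\<^bsub>H1\<^esub>"
      by (rule inj_onD[OF bij_betw_imp_inj_on[OF bij]]) (use y w in auto)
    then have "y = \<zero>\<^bsub>H1\<^esub>" by (rule regD[OF y(1)])
    then show ?thesis using y(2) by simp
  qed
  have "(w, f w) \<in> carrier amalg"
    using w diagonal_in_amalg_set by (simp add: amalgamation_simps)
  moreover have "x = \<zero>\<^bsub>amalg\<^esub>"
    if x: "x \<in> carrier amalg" "x \<otimes>\<^bsub>amalg\<^esub> (w, f w) = \<zero>\<^bsub>amalg\<^esub>" for x
  proof -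
    obtain y j where y: "x = (y, f y \<oplus>\<^bsub>H2\<^esub> j)" "y \<in> carrier H1" "j \<in> carrier H2"
      using x(1) J.a_subset by (auto simp: amalgamation_simps amalg_set_def)
    have "y = \<zero>\<^bsub>H1\<^esub>" using regD y x(2) by (simp add: amalgamation_simps)
    moreover have "f y \<oplus>\<^bsub>H2\<^esub> j = \<zero>\<^bsub>H2\<^esub>" using reg2 y x(2) by (simp add: amalgamation_simps)
    ultimately show ?thesis using y(1) by (simp add: amalgamation_simps)
  qed
  ultimately show ?thesis
    using annihilator_eq_zero_iff[OF amalg.ring_axioms] by blast
qed

text \<open>In a domain it suffices that \<open>w \<noteq> \<zero>\<close>. If \<open>w = \<zero>\<close>, then \<open>b\<close> lies in \<open>J\<close> and is a zero
  divisor; surjectivity of \<open>f\<close> lifts an element killing \<open>b\<close> to the amalgamation, where it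
  contradicts the regularity of \<open>(w, b)\<close>.\<close>

lemma regular_fst:
  assumes surj: "f ` carrier H1 = carrier H2" and dom: "domain H1"
    and zd: "J \<subseteq> zero_divisors H2"
    and x: "(w, b) \<in> carrier amalg" and reg: "annihilator amalg (w, b) = {\<zero>\<^bsub>amalg\<^esub>}"
  shows "annihilator H1 w = {\<zero>\<^bsub>H1\<^esub>}"
proof -
  interpret dom: domain H1 by fact
  obtain i where i: "w \<in> carrier H1" "i \<in> J" "b = f w \<oplus>\<^bsub>H2\<^esub> i"
    using x by (auto simp: amalgamation_simps amalg_set_def)
  have "w \<noteq> \<zero>\<^bsub>H1\<^esub>"
  proof
    assume w: "w = \<zero>\<^bsub>H1\<^esub>"
    then have b: "b = i" using i J.a_subset by auto
    obtain y where y: "y \<in> carrier H2" "y \<noteq> \<zero>\<^bsub>H2\<^esub>" "y \<otimes>\<^bsub>H2\<^esub> i = \<zero>\<^bsub>H2\<^esub>"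
      using mem_zero_divisorsE[OF H2.ring_axioms] zd i(2) by blast
    obtain a where a: "a \<in> carrier H1" "f a = y" using y(1) surj[symmetric] by auto
    have "(a, y) \<in> annihilator amalg (w, b)"
      using a y w b diagonal_in_amalg_set[of a "carrier H1"]
      by (simp add: annihilator_def amalgamation_simps)
    then show False using reg y(2) by (simp add: amalgamation_simps)
  qed
  then show ?thesis
    using dom.integral i(1) by (auto simp: annihilator_eq_zero_iff[OF H1.ring_axioms])
qed

text \<open>If \<open>(s, c)\<close> witnesses the condition in the amalgamation, then \<open>s\<close> witnesses it in
  \<open>H\<^sub>1\<close>: the condition is tested on the diagonal elements \<open>(w, f w)\<close> and \<open>(z, f z)\<close>.\<close>

theorem S_r_ideal_of_amalg:
  assumes iso: "f \<in> ring_iso H1 H2" and A: "ideal A H1" and S: "submonoid S H1"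
    and r: "S_r_ideal (amalg_set H2 f S J) (amalg_set H2 f A J) amalg"
  shows "S_r_ideal S A H1"
proof -
  interpret A: ideal A H1 by fact
  interpret S: submonoid S H1 by fact
  obtain u where u: "u \<in> amalg_set H2 f S J"
    and r': "\<And>x y. x \<in> carrier amalg \<Longrightarrow> y \<in> carrier amalg \<Longrightarrow>
      x \<otimes>\<^bsub>amalg\<^esub> y \<in> amalg_set H2 f A J \<Longrightarrow> annihilator amalg x = {\<zero>\<^bsub>amalg\<^esub>} \<Longrightarrow>
      u \<otimes>\<^bsub>amalg\<^esub> y \<in> amalg_set H2 f A J"
    using r unfolding S_r_ideal_def by blast
  obtain s c where s: "u = (s, c)" "s \<in> S" using u by (auto simp: amalg_set_def)
  have "s \<otimes>\<^bsub>H1\<^esub> z \<in> A"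
    if w: "w \<in> carrier H1" and z: "z \<in> carrier H1" and wz: "w \<otimes>\<^bsub>H1\<^esub> z \<in> A"
      and reg: "annihilator H1 w = {\<zero>\<^bsub>H1\<^esub>}" for w z
  proof -
    have "(w, f w) \<otimes>\<^bsub>amalg\<^esub> (z, f z) \<in> amalg_set H2 f A J"
      using diagonal_in_amalg_set[OF wz] w z by (simp add: amalgamation_simps)
    then have "u \<otimes>\<^bsub>amalg\<^esub> (z, f z) \<in> amalg_set H2 f A J"
      using w z by (intro r'[OF _ _ _ annihilator_diagonal[OF iso w reg]])
        (simp_all add: amalgamation_simps(1) diagonal_in_amalg_set)
    then show ?thesis by (auto simp: s(1) amalgamation_simps amalg_set_def)
  qed
  moreover have "A \<inter> S = {}"
    using r amalg_set_disjoint_iff[OF A.a_subset S.subset] by (simp add: S_r_ideal_def)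
  ultimately show ?thesis
    using A S s(2) unfolding S_r_ideal_def by blast
qed

text \<open>If \<open>s\<close> witnesses the condition in \<open>H\<^sub>1\<close>, then \<open>(s, f s)\<close> witnesses it in the
  amalgamation, since only first components matter once the first component of a regular
  element is known to be regular.\<close>

theorem S_r_ideal_amalg:
  assumes surj: "f ` carrier H1 = carrier H2" and dom: "domain H1"
    and zd: "J \<subseteq> zero_divisors H2" and r: "S_r_ideal S A H1"
  shows "S_r_ideal (amalg_set H2 f S J) (amalg_set H2 f A J) amalg"
proof -
  have A: "ideal A H1" and S: "submonoid S H1" and disj: "A \<inter> S = {}"
    using r by (auto simp: S_r_ideal_def)
  interpret A: ideal A H1 by fact
  interpret S: submonoid S H1 by fact
  obtain s where s: "s \<in> S"
    and r': "\<And>w z. w \<in> carrier H1 \<Longrightarrow> z \<in> carrier H1 \<Longrightarrow> w \<otimes>\<^bsub>H1\<^esub> z \<in> A \<Longrightarrow>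
      annihilator H1 w = {\<zero>\<^bsub>H1\<^esub>} \<Longrightarrow> s \<otimes>\<^bsub>H1\<^esub> z \<in> A"
    using r unfolding S_r_ideal_def by blast
  have sJ: "(s, f s) \<in> amalg_set H2 f S J" "(s, f s) \<in> carrier amalg"
    using s S.subset diagonal_in_amalg_set by (auto simp: amalgamation_simps)
  have "(s, f s) \<otimes>\<^bsub>amalg\<^esub> y \<in> amalg_set H2 f A J"
    if x: "x \<in> carrier amalg" and y: "y \<in> carrier amalg"
      and xy: "x \<otimes>\<^bsub>amalg\<^esub> y \<in> amalg_set H2 f A J"
      and reg: "annihilator amalg x = {\<zero>\<^bsub>amalg\<^esub>}" for x y
  proof -
    obtain w b z c where [simp]: "x = (w, b)" "y = (z, c)" by (cases x, cases y)
    have "w \<in> carrier H1" "z \<in> carrier H1" "w \<otimes>\<^bsub>H1\<^esub> z \<in> A"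
      using x y xy by (auto simp: amalgamation_simps amalg_set_def)
    then have "s \<otimes>\<^bsub>H1\<^esub> z \<in> A"
      using r' regular_fst[OF surj dom zd] x reg by simp
    then show ?thesis
      using amalg.m_closed[OF sJ(2) y]
      by (simp add: amalg_set_eq_vimage[OF A.a_subset] amalgamation_simps(2))
  qed
  then show ?thesis
    using amalg_set_submonoid_amalg[OF S] amalg_set_ideal[OF A] sJ(1) disj
      amalg_set_disjoint_iff[OF A.a_subset S.subset]
    unfolding S_r_ideal_def by blast
qed

end

theorem proposition3p1:
  fixes H1 :: "('a, 'm) ring_scheme" and H2 :: "('b, 'n) ring_scheme"
    and f :: "'a \<Rightarrow> 'b" and J :: "'b set" and A S :: "'a set"
  assumes "cring H1" and "cring H2"
    and "f \<in> ring_hom H1 H2"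
    and "ideal J H2" and "ideal A H1"
    and "submonoid S H1"
  shows "(f \<in> ring_iso H1 H2 \<longrightarrow>
            S_r_ideal (amalg_set H2 f S J) (amalg_set H2 f A J) (amalgamation H1 H2 f J) \<longrightarrow>
            S_r_ideal S A H1) \<and>
         (f ` carrier H1 = carrier H2 \<longrightarrow> domain H1 \<longrightarrow> J \<subseteq> zero_divisors H2 \<longrightarrow>
            S_r_ideal S A H1 \<longrightarrow>
            S_r_ideal (amalg_set H2 f S J) (amalg_set H2 f A J) (amalgamation H1 H2 f J))"
proof -
  interpret cring_amalgamation H1 H2 f J
    using assms(1-4)
    by (intro cring_amalgamation.intro ring_hom_ringI2) (rule cring.axioms | assumption)+
  show ?thesis
    using S_r_ideal_of_amalg[OF _ assms(5,6)] S_r_ideal_amalg by blast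
qed

end
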